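(* Let $X$ and $Y$ be real-valued random variables with marginal support sets $S_X \subseteq \mathbb{R}$ and $S_Y \subseteq \mathbb{R}$, respectively, and with bivariate support set $S_{XY} \subseteq \mathbb{R}^2$. If $X$ and $Y$ are independent, then $$S_{XY} = S_X \times S_Y .$$
   Context: The underlying probability space is $(\mathbb{R}^2, \mathbb{B}^2, P)$, where $\mathbb{B}^k$ denotes the Borel $\sigma$-field on $\mathbb{R}^k$ and $P$ is a probability measure; $X$ and $Y$ are the two coordinate maps, so $P$ is the joint distribution of $(X,Y)$. $\mathbb{R}^k$ carries its Euclidean metric and topology. $X$ and $Y$ are independent iff $P[(X\in B_1) \text{ and } (Y\in B_2)] = P(X\in B_1)\cdot P(Y\in B_2)$ for all $B_1,B_2\in\mathbb{B}^1$. No assumption is made about whether the distributions are discrete, absolutely continuous, singular or mixed. Support sets: with $\mathcal{B}[(x,y),\epsilon]$ the open Euclidean ball of radius $\epsilon$ centered at $(x,y)$, $$S_{XY} = \{(x,y)\in\mathbb{R}^2 : P\{(X,Y)\in\mathcal{B}[(x,y),\epsilon]\}>0 \text{ for all } \epsilon>0\},$$ $$S_X = \{x\in\mathbb{R} : P[X\in(x-\epsilon,x+\epsilon)]>0 \text{ for all } \epsilon>0\},$$ and $S_Y$ is defined analogously to $S_X$. *)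

theory Defs
  imports "HOL-Probability.Probability"
begin

definition support_rv :: "'a measure \<Rightarrow> ('a \<Rightarrow> real) \<Rightarrow> real set" where
  "support_rv M X =
     {x. \<forall>\<epsilon>>0. measure M {\<omega> \<in> space M. X \<omega> \<in> {x - \<epsilon> <..< x + \<epsilon>}} > 0}"

(* The metric of the product type real * real is the Euclidean one (dist_prod_def),
   so ball (x, y) \<epsilon> is the open Euclidean disc. *)
definition joint_support_rv ::
    "'a measure \<Rightarrow> ('a \<Rightarrow> real) \<Rightarrow> ('a \<Rightarrow> real) \<Rightarrow> (real \<times> real) set" where
  "joint_support_rv M X Y =
     {(x, y). \<forall>\<epsilon>>0. measure M {\<omega> \<in> space M. (X \<omega>, Y \<omega>) \<in> ball (x, y) \<epsilon>} > 0}"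

end

theory Submission
  imports Defs
begin

text \<open>
  A point belongs to a support when all its neighbourhoods have positive mass, and any basis of
  neighbourhoods may be used to test this. Discs and open squares around \<open>(x, y)\<close> are nested in each
  other up to a change of radius (\<open>square_subset_ball\<close>, \<open>ball_subset_square\<close>). Since a disc lies in
  the two strips through its centre, a joint support point has both coordinates in the marginal
  supports (\<open>joint_support_rv_subset\<close>). For the converse, every disc contains a square, and
  independence makes the mass of a square the product of the masses of its two sides, which is
  positive over a pair of marginal support points (\<open>support_rv_times_subset\<close>).
\<close>

text \<open>
  The radius is halved because the distance of two points is at most the sum of the distances of
  their coordinates.
\<close>

lemma square_subset_ball:
  fixes x y \<epsilon> :: real
  assumes "\<epsilon> > 0"
  shows "{x - \<epsilon>/2 <..< x + \<epsilon>/2} \<times> {y - \<epsilon>/2 <..< y + \<epsilon>/2} \<subseteq> ball (x, y) \<epsilon>"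
proof clarify
  fix a b :: real
  assume "a \<in> {x - \<epsilon>/2 <..< x + \<epsilon>/2}" "b \<in> {y - \<epsilon>/2 <..< y + \<epsilon>/2}"
  then have "\<bar>x - a\<bar> < \<epsilon>/2" "\<bar>y - b\<bar> < \<epsilon>/2"
    by (simp_all only: abs_less_iff greaterThanLessThan_iff) linarith+
  moreover have "dist (x, y) (a, b) \<le> \<bar>x - a\<bar> + \<bar>y - b\<bar>"
    unfolding dist_prod_def using sqrt_sum_squares_le_sum_abs[of "x - a" "y - b"]
    by (simp add: dist_real_def)
  ultimately show "(a, b) \<in> ball (x, y) \<epsilon>"
    by simp
qed

lemma ball_subset_square:
  fixes x y \<epsilon> :: real
  shows "ball (x, y) \<epsilon> \<subseteq> {x - \<epsilon> <..< x + \<epsilon>} \<times> {y - \<epsilon> <..< y + \<epsilon>}"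
proof clarify
  fix a b :: real
  assume "(a, b) \<in> ball (x, y) \<epsilon>"
  then have "dist x a < \<epsilon>" "dist y b < \<epsilon>"
    using dist_fst_le[of "(x, y)" "(a, b)"] dist_snd_le[of "(x, y)" "(a, b)"] by auto
  then show "a \<in> {x - \<epsilon> <..< x + \<epsilon>} \<and> b \<in> {y - \<epsilon> <..< y + \<epsilon>}"
    by (auto simp: dist_real_def)
qed

context prob_space
begin

text \<open>
  The event that \<open>(X, Y)\<close> hits a disc implies that \<open>X\<close> and \<open>Y\<close> hit the shadows of the disc on the
  two axes, so monotonicity passes positive mass on to the marginals.
\<close>

lemma joint_support_rv_subset:
  assumes [measurable]: "random_variable borel X" "random_variable borel Y"
  shows "joint_support_rv M X Y \<subseteq> support_rv M X \<times> support_rv M Y"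
proof clarify
  fix x y
  assume joint: "(x, y) \<in> joint_support_rv M X Y"
  have "prob {\<omega> \<in> space M. X \<omega> \<in> {x - \<epsilon> <..< x + \<epsilon>}} > 0
      \<and> prob {\<omega> \<in> space M. Y \<omega> \<in> {y - \<epsilon> <..< y + \<epsilon>}} > 0" if "\<epsilon> > 0" for \<epsilon>
  proof -
    let ?D = "{\<omega> \<in> space M. (X \<omega>, Y \<omega>) \<in> ball (x, y) \<epsilon>}"
    have "prob ?D > 0"
      using joint \<open>\<epsilon> > 0\<close> by (simp add: joint_support_rv_def)
    moreover have "prob ?D \<le> prob {\<omega> \<in> space M. X \<omega> \<in> {x - \<epsilon> <..< x + \<epsilon>}}"
      using ball_subset_square[of x y \<epsilon>] by (intro finite_measure_mono) (blast, measurable)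
    moreover have "prob ?D \<le> prob {\<omega> \<in> space M. Y \<omega> \<in> {y - \<epsilon> <..< y + \<epsilon>}}"
      using ball_subset_square[of x y \<epsilon>] by (intro finite_measure_mono) (blast, measurable)
    ultimately show ?thesis
      by linarith
  qed
  then show "x \<in> support_rv M X \<and> y \<in> support_rv M Y"
    by (simp add: support_rv_def)
qed

text \<open>
  Independence is what rules out a null square over two intervals of positive mass; for \<open>Y = X\<close>
  uniform on \<open>[0, 1]\<close>, the joint support is only the diagonal of the square.
\<close>

lemma support_rv_times_subset:
  assumes indep: "indep_var borel X borel Y"
  shows "support_rv M X \<times> support_rv M Y \<subseteq> joint_support_rv M X Y"
proof clarify
  fix x y
  assume x: "x \<in> support_rv M X" and y: "y \<in> support_rv M Y"
  note [measurable] = indep_var_rv1[OF indep] indep_var_rv2[OF indep]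
  have "prob {\<omega> \<in> space M. (X \<omega>, Y \<omega>) \<in> ball (x, y) \<epsilon>} > 0" if "\<epsilon> > 0" for \<epsilon>
  proof -
    let ?I = "{x - \<epsilon>/2 <..< x + \<epsilon>/2}" and ?J = "{y - \<epsilon>/2 <..< y + \<epsilon>/2}"
    have "0 < prob {\<omega> \<in> space M. X \<omega> \<in> ?I} * prob {\<omega> \<in> space M. Y \<omega> \<in> ?J}"
      using x y half_gt_zero[OF \<open>\<epsilon> > 0\<close>] unfolding support_rv_def by (intro mult_pos_pos) blast+
    also have "\<dots> = prob {\<omega> \<in> space M. (X \<omega>, Y \<omega>) \<in> ?I \<times> ?J}"
      using indep_varD[OF indep, of ?I ?J] by (simp add: vimage_def Int_def conj_commute)
    also have "\<dots> \<le> prob {\<omega> \<in> space M. (X \<omega>, Y \<omega>) \<in> ball (x, y) \<epsilon>}"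
    proof (rule finite_measure_mono)
      show "{\<omega> \<in> space M. (X \<omega>, Y \<omega>) \<in> ?I \<times> ?J} \<subseteq> {\<omega> \<in> space M. (X \<omega>, Y \<omega>) \<in> ball (x, y) \<epsilon>}"
        using square_subset_ball[OF \<open>\<epsilon> > 0\<close>] by blast
      have "(\<lambda>\<omega>. (X \<omega>, Y \<omega>)) \<in> borel_measurable M"
        by (rule borel_measurable_Pair) measurable
      from measurable_sets[OF this, of "ball (x, y) \<epsilon>"]
      show "{\<omega> \<in> space M. (X \<omega>, Y \<omega>) \<in> ball (x, y) \<epsilon>} \<in> events"
        by (simp add: vimage_def Int_def conj_commute)
    qed
    finally show ?thesis .
  qed
  then show "(x, y) \<in> joint_support_rv M X Y"
    by (simp add: joint_support_rv_def)
qed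

end

theorem theorem1:
  fixes P :: "(real \<times> real) measure"
  assumes "prob_space P" and "sets P = sets borel"
    and "prob_space.indep_var P borel fst borel snd"
  shows "joint_support_rv P fst snd = support_rv P fst \<times> support_rv P snd"
proof -
  interpret prob_space P
    by fact
  show ?thesis
    using joint_support_rv_subset[OF indep_var_rv1 indep_var_rv2, OF assms(3) assms(3)]
      support_rv_times_subset[OF assms(3)]
    by (rule equalityI)
qed

end
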